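(* Let $n\ge 1$, $\delta\in(0,n]$, $\kappa\in[0,\delta)$ and $p\in(\delta/n,\delta/\kappa)$. Then there exists a constant $c$, depending only on $n$, $\delta$, $\kappa$ and $p$, such that $$\bigg(\int_{\mathbb{R}^n}\big(\mathcal{M}^n_\kappa f(x)\big)^{\frac{\delta p}{\delta-p\kappa}}\,d\mathcal{H}^\delta_\infty\bigg)^{\frac{\delta-p\kappa}{\delta p}}\le c\,\bigg(\int_{\mathbb{R}^n}|f(x)|^p\,d\mathcal{H}^\delta_\infty\bigg)^{\frac1p}$$ for all functions $f:\mathbb{R}^n\to[-\infty,\infty]$ (not assumed to be Lebesgue measurable).
   Context: For $\delta\in(0,n]$ and any set $E\subset\mathbb{R}^n$, the $\delta$-dimensional Hausdorff content is $\mathcal{H}^\delta_\infty(E):=\inf\{\sum_{i} r_i^\delta : E\subset\bigcup_{i} B(x_i,r_i)\}$, the infimum being over all countable (or finite) collections of open balls covering $E$. For an arbitrary set $\Omega\subset\mathbb{R}^n$ and an arbitrary function $g:\Omega\to[0,\infty]$ (no measurability required), the integral with respect to $\mathcal{H}^\delta_\infty$ is the Choquet integral $\int_\Omega g\,d\mathcal{H}^\delta_\infty:=\int_0^\infty \mathcal{H}^\delta_\infty(\{x\in\Omega: g(x)>t\})\,dt$. For $\kappa\in[0,n)$, the Hausdorff content centred fractional maximal function of order $n$ of $f:\mathbb{R}^n\to[-\infty,\infty]$ is $$\mathcal{M}^n_\kappa f(x):=\sup_{r>0}\frac{r^\kappa}{\mathcal{H}^n_\infty(B(x,r))}\int_{B(x,r)}|f(y)|\,d\mathcal{H}^n_\infty(y),\qquad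 x\in\mathbb{R}^n,$$ where $B(x,r)$ is the open ball with centre $x$ and radius $r$. Convention: if $\kappa=0$, then $\delta/\kappa$ is read as $\infty$. *)

theory Defs
  imports "HOL-Analysis.Analysis"
begin

text \<open>The Euclidean space of dimension \<open>n\<close> is \<open>real ^ 'n\<close>, with \<open>n = CARD('n)\<close>.
  Countable families are indexed by arbitrary (finite or infinite) sets of natural numbers.\<close>

definition hausdorff_content :: "real \<Rightarrow> (real ^ 'n) set \<Rightarrow> ennreal" where
  "hausdorff_content \<delta> E =
    Inf {(\<Sum>\<^sub>\<infinity>i\<in>I. ennreal (r i powr \<delta>)) | (I :: nat set) (x :: nat \<Rightarrow> real ^ 'n) (r :: nat \<Rightarrow> real).
      (\<forall>i\<in>I. r i > 0) \<and> E \<subseteq> (\<Union>i\<in>I. ball (x i) (r i))}"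

text \<open>The level function \<open>t \<mapsto> H {x \<in> \<Omega>. g x > t}\<close> is nonincreasing for monotone \<open>H\<close>, hence
  Borel measurable, so the outer integral is a genuine Lebesgue integral even
  if \<open>\<Omega>\<close> and \<open>g\<close> are not measurable.\<close>

definition choquet_integral :: "('a set \<Rightarrow> ennreal) \<Rightarrow> 'a set \<Rightarrow> ('a \<Rightarrow> ennreal) \<Rightarrow> ennreal" where
  "choquet_integral H \<Omega> g = (\<integral>\<^sup>+t\<in>{0..}. H {x \<in> \<Omega>. g x > ennreal t} \<partial>lborel)"

text \<open>Powers of extended nonnegative reals; used for exponents \<open>a > 0\<close> only, where
  \<open>\<infinity>\<^sup>a = \<infinity>\<close> and \<open>0\<^sup>a = 0\<close>.\<close>

definition ennreal_powr :: "ennreal \<Rightarrow> real \<Rightarrow> ennreal" where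
  "ennreal_powr x a = (if x = \<infinity> then \<infinity> else ennreal (enn2real x powr a))"

definition content_maximal :: "real \<Rightarrow> (real ^ 'n \<Rightarrow> ereal) \<Rightarrow> real ^ 'n \<Rightarrow> ennreal" where
  "content_maximal \<kappa> f x =
    (SUP r\<in>{0<..}. ennreal (r powr \<kappa>) / hausdorff_content (real CARD('n)) (ball x r) *
      choquet_integral (hausdorff_content (real CARD('n))) (ball x r) (\<lambda>y. e2ennreal \<bar>f y\<bar>))"

end

theory Submission
  imports Defs
begin

text \<open>Write \<open>H\<^sup>\<delta>\<close> for the \<open>\<delta>\<close>-dimensional content and \<open>M\<close> for the maximal function with \<open>\<kappa> = 0\<close>.
  The content is not additive and its Choquet integral need not be sublinear, so the argument works with
  level sets and coverings by balls throughout.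

  The core is a weak type estimate at the critical exponent \<open>\<delta> / n\<close> (\<open>maximal_weak_type\<close>):
  \<open>H\<^sup>\<delta> {M f > 2 T} \<le> C \<Sum>\<^sub>m 2\<^sup>m\<^sup>\<delta>\<^sup>/\<^sup>n H\<^sup>\<delta> {\<bar>f\<bar> > 2\<^sup>m T}\<close>. Cover each level set
  \<open>{\<bar>f\<bar> > 2\<^sup>m T}\<close> almost optimally by balls. Away from the tripled covering balls, an average of
  \<open>\<bar>f\<bar>\<close> over \<open>ball x r\<close> sees only covering balls centred in \<open>ball x (2 * r)\<close>, and
  \<open>(\<Sum> a\<^sub>i)\<^sup>\<delta>\<^sup>/\<^sup>n \<le> \<Sum> a\<^sub>i\<^sup>\<delta>\<^sup>/\<^sup>n\<close> bounds \<open>r\<^sup>\<delta>\<close> by the mass of \<open>ball x (2 * r)\<close> under a discrete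
  measure carried by the centres. Vitali's covering lemma then finishes the estimate.

  Raising to the power \<open>p\<close> and integrating over all heights gives, because \<open>p > \<delta> / n\<close>, a convergent
  geometric series and the strong type estimate for \<open>M\<close> (\<open>maximal_strong_type\<close>). This handles
  \<open>p \<le> 1\<close> and \<open>p > 1\<close>, \<open>\<delta> < n\<close> and \<open>\<delta> = n\<close>, at once.

  For general \<open>\<kappa>\<close>, let \<open>F = (\<integral> \<bar>f\<bar>\<^sup>p dH\<^sup>\<delta>)\<^sup>1\<^sup>/\<^sup>p\<close>. The averages are also at most
  \<open>C r\<^sup>-\<^sup>\<delta>\<^sup>/\<^sup>p F\<close> (\<open>choquet_ball_le_powr\<close>), and interpolation with \<open>M f\<close> gives the pointwise Hedberg bound
  \<open>M\<^sub>\<kappa> f \<le> C (M f)\<^sup>1\<^sup>-\<^sup>\<theta> F\<^sup>\<theta>\<close> with \<open>\<theta> = p \<kappa> / \<delta>\<close> (\<open>content_maximal_le_Hedberg\<close>). Its power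
  \<open>\<delta> p / (\<delta> - p \<kappa>) = p / (1 - \<theta>)\<close> is integrated by the strong type estimate.\<close>

section \<open>Hausdorff content and coverings\<close>

lemma infsum_nat_ennreal: "(\<Sum>\<^sub>\<infinity>i\<in>I. f i) = (\<integral>\<^sup>+i. f i \<partial>count_space I)" for f :: "nat \<Rightarrow> ennreal"
proof -
  have "(\<Sum>\<^sub>\<infinity>i\<in>I. f i) = (\<Sum>\<^sub>\<infinity>i\<in>UNIV. f i * indicator I i)"
    by (rule infsum_cong_neutral) auto
  also have "\<dots> = (\<Sum>i. f i * indicator I i)"
    by (rule sums_unique[OF has_sum_imp_sums[OF has_sum_infsum]])
      (rule nonneg_summable_on_complete, simp)
  also have "\<dots> = (\<integral>\<^sup>+i. f i * indicator I i \<partial>count_space UNIV)"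
    by (simp add: nn_integral_count_space_nat)
  also have "\<dots> = (\<integral>\<^sup>+i. f i \<partial>count_space I)"
    by (simp add: nn_integral_count_space_indicator)
  finally show ?thesis .
qed

lemma nn_integral_count_space_mono:
  "A \<subseteq> B \<Longrightarrow> (\<integral>\<^sup>+i. f i \<partial>count_space A) \<le> (\<integral>\<^sup>+i. f i \<partial>count_space B)"
  by (subst (1 2) nn_integral_count_space_indicator) (auto intro!: nn_integral_mono split: split_indicator)

text \<open>The content is bounded by the cost of any countable covering, indexed by an arbitrary type.
  Radii need not be positive: a nonpositive radius gives an empty ball, and such indices are
  discarded. This allows coverings to be trimmed by setting radii to \<open>0\<close>, which costs nothing.\<close>

lemma content_le_cover:
  fixes x :: "'i \<Rightarrow> real ^ 'n"
  assumes I: "countable I" and E: "E \<subseteq> (\<Union>i\<in>I. ball (x i) (r i))"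
  shows "hausdorff_content \<delta> E \<le> (\<integral>\<^sup>+i. ennreal (r i powr \<delta>) \<partial>count_space I)"
proof -
  define P where "P = {i\<in>I. r i > 0}"
  define J where "J = to_nat_on P ` P"
  have P: "countable P" using I by (auto simp: P_def)
  have bij: "bij_betw (from_nat_into P) J P"
    unfolding J_def using P by (auto intro!: bij_betw_byWitness[where f'="to_nat_on P"])
  have inv: "from_nat_into P (to_nat_on P i) = i" if "i \<in> P" for i
    using P that by simp
  have "(\<Sum>\<^sub>\<infinity>k\<in>J. ennreal (r (from_nat_into P k) powr \<delta>)) = (\<integral>\<^sup>+i. ennreal (r i powr \<delta>) \<partial>count_space P)"
    unfolding infsum_nat_ennreal by (rule nn_integral_bij_count_space[OF bij])
  also have "\<dots> \<le> (\<integral>\<^sup>+i. ennreal (r i powr \<delta>) \<partial>count_space I)"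
    by (intro nn_integral_count_space_mono) (auto simp: P_def)
  finally have le: "(\<Sum>\<^sub>\<infinity>k\<in>J. ennreal (r (from_nat_into P k) powr \<delta>))
      \<le> (\<integral>\<^sup>+i. ennreal (r i powr \<delta>) \<partial>count_space I)" .
  have "\<exists>k\<in>J. y \<in> ball (x (from_nat_into P k)) (r (from_nat_into P k))" if yE: "y \<in> E" for y
  proof -
    obtain i where i: "i \<in> I" "y \<in> ball (x i) (r i)" using E yE by blast
    then have "i \<in> P" by (auto simp: P_def intro: le_less_trans[OF zero_le_dist])
    with i show ?thesis using inv by (auto simp: J_def)
  qed
  moreover have "\<forall>k\<in>J. r (from_nat_into P k) > 0" using inv by (auto simp: J_def P_def)
  ultimately have "hausdorff_content \<delta> E \<le> (\<Sum>\<^sub>\<infinity>k\<in>J. ennreal (r (from_nat_into P k) powr \<delta>))"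
    unfolding hausdorff_content_def
    by (intro Inf_lower CollectI exI[of _ J] exI[of _ "\<lambda>k. x (from_nat_into P k)"]
        exI[of _ "\<lambda>k. r (from_nat_into P k)"]) auto
  with le show ?thesis by (rule order_trans[rotated])
qed

lemma content_cover:
  fixes E :: "(real ^ 'n) set"
  assumes "hausdorff_content \<delta> E < c"
  obtains x :: "nat \<Rightarrow> real ^ 'n" and r where "\<And>i. r i \<ge> 0" "E \<subseteq> (\<Union>i. ball (x i) (r i))"
    "(\<integral>\<^sup>+i. ennreal (r i powr \<delta>) \<partial>count_space UNIV) < c"
proof -
  obtain I x and r :: "nat \<Rightarrow> real" where I: "\<forall>i\<in>I. r i > 0" "E \<subseteq> (\<Union>i\<in>I. ball (x i) (r i))"
    "(\<Sum>\<^sub>\<infinity>i\<in>I. ennreal (r i powr \<delta>)) < c"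
    using assms unfolding hausdorff_content_def Inf_less_iff by blast
  define r' where "r' i = (if i \<in> I then r i else 0)" for i
  have "(\<integral>\<^sup>+i. ennreal (r' i powr \<delta>) \<partial>count_space UNIV) = (\<integral>\<^sup>+i. ennreal (r i powr \<delta>) \<partial>count_space I)"
    unfolding r'_def
    by (subst nn_integral_count_space_indicator) (auto intro!: nn_integral_cong split: split_indicator)
  with I(3) have "(\<integral>\<^sup>+i. ennreal (r' i powr \<delta>) \<partial>count_space UNIV) < c"
    by (simp add: infsum_nat_ennreal)
  moreover have "E \<subseteq> (\<Union>i. ball (x i) (r' i))"
  proof
    fix y assume "y \<in> E"
    then obtain i where "i \<in> I" "y \<in> ball (x i) (r i)" using I(2) by blast
    then show "y \<in> (\<Union>i. ball (x i) (r' i))" by (auto simp: r'_def intro!: exI[of _ i])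
  qed
  ultimately show ?thesis
    using I(1) by (intro that[of r' x]) (auto simp: r'_def intro: less_imp_le)
qed

lemma hausdorff_content_empty [simp]: "hausdorff_content \<delta> {} = 0"
  using content_le_cover[of "{}" "{}" undefined undefined \<delta>] by (simp add: nn_integral_count_space_finite)

lemma content_mono: "A \<subseteq> B \<Longrightarrow> hausdorff_content \<delta> A \<le> hausdorff_content \<delta> B"
  unfolding hausdorff_content_def by (rule Inf_superset_mono) blast

lemma ennreal_add_less_self: "a < top \<Longrightarrow> 0 < b \<Longrightarrow> a < a + ennreal b"
  by (cases a) (auto simp: ennreal_plus[symmetric] ennreal_less_iff simp del: ennreal_plus)

lemma content_Un:
  "hausdorff_content \<delta> (A \<union> B) \<le> hausdorff_content \<delta> A + hausdorff_content \<delta> B"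
proof (rule ennreal_le_epsilon)
  fix e :: real
  assume fin: "hausdorff_content \<delta> A + hausdorff_content \<delta> B < top" and "e > 0"
  then have "hausdorff_content \<delta> A < hausdorff_content \<delta> A + ennreal (e / 2)"
    "hausdorff_content \<delta> B < hausdorff_content \<delta> B + ennreal (e / 2)"
    by (auto simp: ennreal_zero_less_divide intro!: ennreal_add_less_self)
  note less = this
  obtain x r where c1: "A \<subseteq> (\<Union>i. ball (x i) (r i))"
    and s1: "(\<integral>\<^sup>+i. ennreal (r i powr \<delta>) \<partial>count_space (UNIV::nat set)) < hausdorff_content \<delta> A + ennreal (e / 2)"
    by (rule content_cover[OF less(1)]) blast
  obtain y s where c2: "B \<subseteq> (\<Union>i. ball (y i) (s i))"
    and s2: "(\<integral>\<^sup>+i. ennreal (s i powr \<delta>) \<partial>count_space (UNIV::nat set)) < hausdorff_content \<delta> B + ennreal (e / 2)"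
    by (rule content_cover[OF less(2)]) blast
  have "hausdorff_content \<delta> (A \<union> B) \<le> (\<integral>\<^sup>+p. ennreal ((case p of (b, i) \<Rightarrow> if b then r i else s i) powr \<delta>) \<partial>count_space UNIV)"
  proof (rule content_le_cover[where x="\<lambda>(b, i). if b then x i else y i"])
    have "ball (x i) (r i) \<subseteq> (\<Union>p. ball (case p of (b, i) \<Rightarrow> if b then x i else y i) (case p of (b, i) \<Rightarrow> if b then r i else s i))" for i
      by (rule order_trans[OF _ UN_upper[of "(True, i)"]]) auto
    moreover have "ball (y i) (s i) \<subseteq> (\<Union>p. ball (case p of (b, i) \<Rightarrow> if b then x i else y i) (case p of (b, i) \<Rightarrow> if b then r i else s i))" for i
      by (rule order_trans[OF _ UN_upper[of "(False, i)"]]) auto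
    ultimately show "A \<union> B \<subseteq> (\<Union>p. ball (case p of (b, i) \<Rightarrow> if b then x i else y i) (case p of (b, i) \<Rightarrow> if b then r i else s i))"
      by (intro Un_least order_trans[OF c1] order_trans[OF c2] UN_least)
  qed auto
  also have "\<dots> = (\<integral>\<^sup>+b. \<integral>\<^sup>+i. ennreal ((if b then r i else s i) powr \<delta>) \<partial>count_space UNIV \<partial>count_space UNIV)"
    by (subst nn_integral_fst_count_space[symmetric]) simp
  also have "\<dots> = (\<integral>\<^sup>+i. ennreal (r i powr \<delta>) \<partial>count_space UNIV) + (\<integral>\<^sup>+i. ennreal (s i powr \<delta>) \<partial>count_space UNIV)"
    by (subst nn_integral_count_space_finite) (auto simp: UNIV_bool add.commute)
  also have "\<dots> \<le> (hausdorff_content \<delta> A + ennreal (e / 2)) + (hausdorff_content \<delta> B + ennreal (e / 2))"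
    using s1 s2 by (intro add_mono) auto
  also have "\<dots> = hausdorff_content \<delta> A + hausdorff_content \<delta> B + (ennreal (e / 2) + ennreal (e / 2))"
    by (simp add: ac_simps)
  also have "ennreal (e / 2) + ennreal (e / 2) = ennreal e"
    using \<open>e > 0\<close> by (subst ennreal_plus[symmetric]) auto
  finally show "hausdorff_content \<delta> (A \<union> B) \<le> hausdorff_content \<delta> A + hausdorff_content \<delta> B + ennreal e" .
qed

text \<open>In the top dimension the content of a ball is exactly what the single ball costs; a cheaper
  covering would contradict the countable subadditivity of Lebesgue measure.\<close>

lemma content_ball:
  fixes x :: "real ^ 'n"
  assumes "r > 0"
  shows "hausdorff_content (real CARD('n)) (ball x r) = ennreal (r ^ CARD('n))"
proof (rule antisym)
  have "hausdorff_content (real CARD('n)) (ball x r) \<le> (\<integral>\<^sup>+i. ennreal (r powr real CARD('n)) \<partial>count_space {()})"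
    by (rule content_le_cover[where x="\<lambda>_. x"]) auto
  also have "\<dots> = ennreal (r ^ CARD('n))"
    using assms by (simp add: nn_integral_count_space_finite powr_realpow)
  finally show "hausdorff_content (real CARD('n)) (ball x r) \<le> ennreal (r ^ CARD('n))" .
next
  define v where "v = unit_ball_vol (real CARD('n))"
  have v: "v > 0" by (simp add: v_def)
  have vol: "emeasure lborel (ball y s) = ennreal v * ennreal (s powr real CARD('n))" if "s \<ge> 0" for y :: "real ^ 'n" and s
    using that v by (cases "s = 0") (auto simp: emeasure_ball v_def powr_realpow ennreal_mult'')
  show "ennreal (r ^ CARD('n)) \<le> hausdorff_content (real CARD('n)) (ball x r)"
  proof (rule ccontr)
    assume "\<not> ?thesis"
    then obtain y :: "nat \<Rightarrow> real ^ 'n" and s where s: "\<And>i. s i \<ge> 0" and c: "ball x r \<subseteq> (\<Union>i. ball (y i) (s i))"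
      and less: "(\<integral>\<^sup>+i. ennreal (s i powr real CARD('n)) \<partial>count_space UNIV) < ennreal (r ^ CARD('n))"
      unfolding not_le by (rule content_cover) blast
    have "ennreal v * ennreal (r ^ CARD('n)) = emeasure lborel (ball x r)"
      using vol[of r x] assms by (simp add: powr_realpow)
    also have "\<dots> \<le> emeasure lborel (\<Union>i. ball (y i) (s i))"
      by (rule emeasure_mono[OF c]) auto
    also have "\<dots> \<le> (\<Sum>i. emeasure lborel (ball (y i) (s i)))"
      by (rule emeasure_subadditive_countably) auto
    also have "\<dots> = ennreal v * (\<integral>\<^sup>+i. ennreal (s i powr real CARD('n)) \<partial>count_space UNIV)"
      using vol[OF s] by (simp add: nn_integral_count_space_nat)
    finally show False
      using less v by (simp add: ennreal_mult_le_mult_iff)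
  qed
qed

text \<open>The inequality \<open>\<Sum> a\<^sub>i\<^sup>s \<le> (\<Sum> a\<^sub>i)\<^sup>s\<close> for \<open>s \<ge> 1\<close>: each \<open>a\<^sub>i\<close> is at most
  the sum \<open>c\<close>, so \<open>a\<^sub>i\<^sup>s \<le> c\<^sup>s\<^sup>-\<^sup>1 a\<^sub>i\<close>.\<close>

lemma nn_integral_powr_le:
  fixes a :: "'i \<Rightarrow> real"
  assumes a: "\<And>i. i \<in> I \<Longrightarrow> a i \<ge> 0" and s: "s \<ge> 1" and c: "c \<ge> 0"
    and le: "(\<integral>\<^sup>+i. ennreal (a i) \<partial>count_space I) \<le> ennreal c"
  shows "(\<integral>\<^sup>+i. ennreal (a i powr s) \<partial>count_space I) \<le> ennreal (c powr s)"
proof -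
  have "a i \<le> c" if "i \<in> I" for i
  proof -
    have "ennreal (a i) = (\<integral>\<^sup>+i. ennreal (a i) \<partial>count_space {i})"
      by (simp add: nn_integral_count_space_finite)
    also have "\<dots> \<le> (\<integral>\<^sup>+i. ennreal (a i) \<partial>count_space I)"
      using that by (intro nn_integral_count_space_mono) auto
    also note le
    finally show ?thesis using c by simp
  qed
  then have pw: "a i powr s \<le> c powr (s - 1) * a i" if "i \<in> I" for i
  proof (cases "a i = 0")
    case False
    then have "a i powr s = a i powr (s - 1) * a i"
      using a[OF that] powr_add[of "a i" "s - 1" 1] by simp
    also have "\<dots> \<le> c powr (s - 1) * a i"
      using a[OF that] s \<open>i \<in> I \<Longrightarrow> a i \<le> c\<close>[OF that] by (intro mult_right_mono powr_mono2) auto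
    finally show ?thesis .
  qed simp
  have "(\<integral>\<^sup>+i. ennreal (a i powr s) \<partial>count_space I) \<le> (\<integral>\<^sup>+i. ennreal (c powr (s - 1)) * ennreal (a i) \<partial>count_space I)"
    using pw a by (intro nn_integral_mono) (auto simp: ennreal_mult'[symmetric] intro!: ennreal_leI)
  also have "\<dots> \<le> ennreal (c powr (s - 1)) * ennreal c"
    using le by (subst nn_integral_cmult) (auto intro: mult_left_mono)
  also have "\<dots> = ennreal (c powr s)"
    using c s by (cases "c = 0") (auto simp: ennreal_mult''[symmetric] powr_diff)
  finally show ?thesis .
qed

text \<open>A covering that is cheap in dimension \<open>\<delta>\<close> is cheap in every larger dimension \<open>e\<close>:
  \<open>H\<^sup>e(E) \<le> H\<^sup>\<delta>(E)\<^sup>e\<^sup>/\<^sup>\<delta>\<close>.\<close>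

lemma content_le_powr_content:
  fixes E :: "(real ^ 'n) set"
  assumes d: "0 < \<delta>" "\<delta> \<le> e" and c: "0 \<le> c" and le: "hausdorff_content \<delta> E \<le> ennreal c"
  shows "hausdorff_content e E \<le> ennreal (c powr (e / \<delta>))"
proof -
  have *: "hausdorff_content e E \<le> ennreal (b powr (e / \<delta>))" if b: "c < b" for b
  proof -
    have "hausdorff_content \<delta> E < ennreal b" using le b c by (simp add: le_less_trans ennreal_lessI)
    then obtain x :: "nat \<Rightarrow> real ^ 'n" and r where r: "\<And>i. r i \<ge> 0" and E: "E \<subseteq> (\<Union>i. ball (x i) (r i))"
      and s: "(\<integral>\<^sup>+i. ennreal (r i powr \<delta>) \<partial>count_space UNIV) < ennreal b"
      by (rule content_cover) blast
    have "hausdorff_content e E \<le> (\<integral>\<^sup>+i. ennreal (r i powr e) \<partial>count_space UNIV)"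
      by (rule content_le_cover[OF _ E]) auto
    also have "\<dots> = (\<integral>\<^sup>+i. ennreal ((r i powr \<delta>) powr (e / \<delta>)) \<partial>count_space UNIV)"
      using d by (simp add: powr_powr)
    also have "\<dots> \<le> ennreal (b powr (e / \<delta>))"
      using d s b c by (intro nn_integral_powr_le) auto
    finally show ?thesis .
  qed
  have "((\<lambda>b. ennreal (b powr (e / \<delta>))) \<longlongrightarrow> ennreal (c powr (e / \<delta>))) (at_right c)"
    using d c by (intro tendsto_ennrealI tendsto_powr' tendsto_intros)
      (auto intro!: eventually_at_rightI[of 0 1])
  then show ?thesis
    by (rule tendsto_lowerbound) (auto intro!: * eventually_at_rightI[of c "c+1"])
qed

section \<open>Choquet integrals and level sets\<close>

lemma antimono_borel_measurable:
  fixes \<Phi> :: "real \<Rightarrow> ennreal"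
  assumes "antimono \<Phi>"
  shows "\<Phi> \<in> borel_measurable borel"
proof (rule borel_measurableI_greater)
  fix y
  have "is_interval {x. y < \<Phi> x}"
    unfolding is_interval_1 using antimonoD[OF assms] by (auto intro: less_le_trans)
  then show "{x \<in> space borel. y < \<Phi> x} \<in> sets borel"
    by (simp add: real_interval_borel_measurable)
qed

lemma antimono_content_level:
  "antimono (\<lambda>t. hausdorff_content \<delta> {x\<in>\<Omega>. ennreal t < g x})"
  by (intro antimonoI content_mono) (auto intro: le_less_trans[OF ennreal_leI])

lemma borel_content_level [measurable]:
  "(\<lambda>t. hausdorff_content \<delta> {x\<in>\<Omega>. ennreal t < g x}) \<in> borel_measurable borel"
  by (rule antimono_borel_measurable[OF antimono_content_level])

lemma suminf_ge_term: "f m \<le> (\<Sum>m. f m)" for f :: "nat \<Rightarrow> ennreal"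
  using sum_le_suminf[of f "{m}"] by simp

text \<open>A dyadic upper sum for the integral of a nonincreasing function, with the value at \<open>0\<close> used
  on \<open>[0, T)\<close> and the value at \<open>2\<^sup>m T\<close> on \<open>[2\<^sup>m T, 2\<^sup>m\<^sup>+\<^sup>1 T)\<close>. It reduces Choquet integrals to
  level sets, so that no subadditivity of the Choquet integral is needed.\<close>

lemma nn_integral_antimono_le:
  fixes \<Phi> :: "real \<Rightarrow> ennreal"
  assumes anti: "antimono \<Phi>" and T: "T > 0"
  shows "(\<integral>\<^sup>+t\<in>{0..}. \<Phi> t \<partial>lborel) \<le> ennreal T * \<Phi> 0 + (\<Sum>m. ennreal (T * 2 ^ m) * \<Phi> (T * 2 ^ m))"
proof -
  have pw: "\<Phi> t * indicator {0..} t \<le> \<Phi> 0 * indicator {0..<T} t +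
      (\<Sum>m. \<Phi> (T * 2 ^ m) * indicator {T * 2 ^ m..<T * 2 ^ Suc m} t)" for t
  proof -
    consider "t < 0" | "0 \<le> t" "t < T" | "T \<le> t" by linarith
    then show ?thesis
    proof cases
      case 2
      then show ?thesis using antimonoD[OF anti, of 0 t] by (auto intro: add_increasing2)
    next
      case 3
      define k where "k = (LEAST k. t < T * 2 ^ k)"
      obtain j :: nat where "t / T < 2 ^ j" using real_arch_pow[of 2 "t / T"] by auto
      then have "t < T * 2 ^ j" using T by (simp add: field_simps)
      then have k: "t < T * 2 ^ k" unfolding k_def by (rule LeastI)
      with 3 have "k \<noteq> 0" by (intro notI) simp
      then obtain m where m: "k = Suc m" by (cases k) auto
      then have "\<not> t < T * 2 ^ m" using not_less_Least[of m "\<lambda>k. t < T * 2 ^ k"] by (simp add: k_def)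
      with k m have "\<Phi> t * indicator {0..} t \<le> \<Phi> (T * 2 ^ m) * indicator {T * 2 ^ m..<T * 2 ^ Suc m} t"
        using 3 T antimonoD[OF anti, of "T * 2 ^ m" t] by auto
      also have "\<dots> \<le> (\<Sum>m. \<Phi> (T * 2 ^ m) * indicator {T * 2 ^ m..<T * 2 ^ Suc m} t)"
        by (rule suminf_ge_term)
      finally show ?thesis by (auto intro: add_increasing)
    qed simp
  qed
  have "(\<integral>\<^sup>+t\<in>{0..}. \<Phi> t \<partial>lborel) \<le> (\<integral>\<^sup>+t. \<Phi> 0 * indicator {0..<T} t +
      (\<Sum>m. \<Phi> (T * 2 ^ m) * indicator {T * 2 ^ m..<T * 2 ^ Suc m} t) \<partial>lborel)"
    by (intro nn_integral_mono pw)
  also have "\<dots> = \<Phi> 0 * ennreal T + (\<Sum>m. \<Phi> (T * 2 ^ m) * ennreal (T * 2 ^ m))"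
    using T by (simp add: nn_integral_add nn_integral_suminf nn_integral_cmult_indicator)
  finally show ?thesis by (simp add: mult.commute)
qed

lemma choquet_ball_le:
  fixes x :: "real ^ 'n"
  assumes T: "T > 0" and r: "r > 0"
  shows "choquet_integral (hausdorff_content (real CARD('n))) (ball x r) g \<le>
    ennreal (T * r ^ CARD('n)) +
    (\<Sum>m. ennreal (T * 2 ^ m) * hausdorff_content (real CARD('n)) {y\<in>ball x r. ennreal (T * 2 ^ m) < g y})"
proof -
  have "hausdorff_content (real CARD('n)) {y\<in>ball x r. ennreal 0 < g y} \<le> ennreal (r ^ CARD('n))"
    using r by (subst content_ball[symmetric, of r x]) (auto intro!: content_mono)
  then have "ennreal T * hausdorff_content (real CARD('n)) {y\<in>ball x r. ennreal 0 < g y} \<le> ennreal (T * r ^ CARD('n))"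
    using T r by (simp add: ennreal_mult' mult_left_mono)
  with nn_integral_antimono_le[OF antimono_content_level T, of "real CARD('n)" "ball x r" g]
  show ?thesis
    unfolding choquet_integral_def by (meson add_right_mono order_trans)
qed

lemma choquet_chebyshev:
  assumes t: "t \<ge> 0"
  shows "ennreal t * hausdorff_content \<delta> {x\<in>\<Omega>. ennreal t < g x} \<le> choquet_integral (hausdorff_content \<delta>) \<Omega> g"
proof -
  have "ennreal t * hausdorff_content \<delta> {x\<in>\<Omega>. ennreal t < g x} =
      (\<integral>\<^sup>+s. hausdorff_content \<delta> {x\<in>\<Omega>. ennreal t < g x} * indicator {0..<t} s \<partial>lborel)"
    using t by (subst nn_integral_cmult_indicator) (auto simp: mult.commute)
  also have "\<dots> \<le> (\<integral>\<^sup>+s\<in>{0..}. hausdorff_content \<delta> {x\<in>\<Omega>. ennreal s < g x} \<partial>lborel)"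
    by (intro nn_integral_mono)
      (auto split: split_indicator intro!: antimonoD[OF antimono_content_level])
  finally show ?thesis by (simp add: choquet_integral_def)
qed

lemma less_ennreal_powr_iff:
  assumes "t \<ge> 0" "a > 0"
  shows "ennreal (t powr a) < ennreal_powr x a \<longleftrightarrow> ennreal t < x"
proof (cases x)
  case (real u)
  have "t powr a < u powr a \<longleftrightarrow> t < u"
    using assms real by (metis less_le_not_le not_le powr_less_mono2 powr_mono2 less_imp_le)
  with real assms show ?thesis by (simp add: ennreal_powr_def ennreal_less_iff)
qed (simp add: ennreal_powr_def)

lemma ennreal_powr_le:
  assumes "X \<le> ennreal y" "0 \<le> y" "0 < a"
  shows "ennreal_powr X a \<le> ennreal (y powr a)"
  using assms by (cases X) (auto simp: ennreal_powr_def top_unique intro!: ennreal_leI powr_mono2)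

lemma ennreal_le_divideI:
  assumes "a > 0" "ennreal a * X \<le> ennreal b" "b \<ge> 0"
  shows "X \<le> ennreal (b / a)"
  using assms by (cases X) (auto simp: ennreal_mult[symmetric] ennreal_mult_top top_unique field_simps)

lemma supercritical_exponent:
  fixes \<delta> p :: real
  assumes "0 < \<delta>" "\<delta> / real CARD('n::finite) < p"
  shows "0 < p" "2 powr (1 - p * real CARD('n) / \<delta>) < 1"
proof -
  have "0 < \<delta> / real CARD('n)" using assms(1) by simp
  then show "0 < p" using assms(2) by linarith
  have "1 - p * real CARD('n) / \<delta> < 0" using assms by (simp add: field_simps)
  then show "2 powr (1 - p * real CARD('n) / \<delta>) < 1" using powr_less_mono[of _ 0 2] by simp
qed

text \<open>An average over a ball of radius \<open>r\<close> is at most a constant times \<open>T\<close> as soon as the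
  \<open>p\<close>-integral \<open>G\<close> is at most \<open>T\<^sup>p r\<^sup>\<delta>\<close>; with the optimal \<open>T\<close> this is the bound
  \<open>G\<^sup>1\<^sup>/\<^sup>p r\<^sup>-\<^sup>\<delta>\<^sup>/\<^sup>p\<close>. By Chebyshev the level set at \<open>2\<^sup>m T\<close> has \<open>\<delta>\<close>-content at most
  \<open>2\<^sup>-\<^sup>m\<^sup>p r\<^sup>\<delta>\<close>, hence \<open>n\<close>-content at most \<open>2\<^sup>-\<^sup>m\<^sup>p\<^sup>n\<^sup>/\<^sup>\<delta> r\<^sup>n\<close>, and the dyadic sum is
  geometric with ratio \<open>q < 1\<close>. Keeping \<open>T\<close> free also covers the case \<open>G = 0\<close>.\<close>

lemma choquet_ball_le_powr:
  fixes x :: "real ^ 'n" and \<delta> p G :: real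
  defines "q \<equiv> 2 powr (1 - p * real CARD('n) / \<delta>)"
  assumes d: "0 < \<delta>" "\<delta> \<le> real CARD('n)" and p: "\<delta> / real CARD('n) < p"
    and T: "T > 0" and r: "r > 0"
    and G: "choquet_integral (hausdorff_content \<delta>) UNIV (\<lambda>x. ennreal_powr (g x) p) \<le> ennreal G"
      "0 \<le> G" "G \<le> T powr p * r powr \<delta>"
  shows "choquet_integral (hausdorff_content (real CARD('n))) (ball x r) g
    \<le> ennreal ((1 + 1 / (1 - q)) * (T * r ^ CARD('n)))"
proof -
  let ?n = "real CARD('n)"
  have p0: "p > 0" by (rule supercritical_exponent(1)[OF d(1) p])
  have q: "0 < q" "q < 1"
    unfolding q_def using supercritical_exponent(2)[OF d(1) p] by auto
  have lev: "ennreal (T * 2 ^ m) * hausdorff_content ?n {y\<in>ball x r. ennreal (T * 2 ^ m) < g y}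
      \<le> ennreal (T * r ^ CARD('n) * q ^ m)" for m
  proof -
    define t where "t = T * 2 ^ m"
    have t: "t > 0" using T by (simp add: t_def)
    have "ennreal (t powr p) * hausdorff_content \<delta> {y. ennreal t < g y}
        \<le> choquet_integral (hausdorff_content \<delta>) UNIV (\<lambda>x. ennreal_powr (g x) p)"
      using choquet_chebyshev[of "t powr p" \<delta> UNIV "\<lambda>x. ennreal_powr (g x) p"] t p0
      by (simp add: less_ennreal_powr_iff)
    also have "\<dots> \<le> ennreal (T powr p * r powr \<delta>)"
      using G by (meson ennreal_leI order_trans)
    finally have "hausdorff_content \<delta> {y. ennreal t < g y} \<le> ennreal (T powr p * r powr \<delta> / t powr p)"
      using t by (intro ennreal_le_divideI) auto
    also have "T powr p * r powr \<delta> / t powr p = r powr \<delta> * 2 powr (- (real m * p))"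
      using T by (simp add: t_def powr_mult powr_minus field_simps powr_realpow[symmetric] powr_powr)
    finally have "hausdorff_content ?n {y. ennreal t < g y} \<le> ennreal ((r powr \<delta> * 2 powr (- (real m * p))) powr (?n / \<delta>))"
      using d by (intro content_le_powr_content) auto
    also have "(r powr \<delta> * 2 powr (- (real m * p))) powr (?n / \<delta>) = r ^ CARD('n) * 2 powr (- (real m * p * ?n / \<delta>))"
      using r d by (simp add: powr_mult powr_powr powr_realpow)
    finally have "hausdorff_content ?n {y\<in>ball x r. ennreal t < g y} \<le> ennreal (r ^ CARD('n) * 2 powr (- (real m * p * ?n / \<delta>)))"
      by (rule order_trans[OF content_mono, rotated]) auto
    then have "ennreal t * hausdorff_content ?n {y\<in>ball x r. ennreal t < g y}
        \<le> ennreal (t * (r ^ CARD('n) * 2 powr (- (real m * p * ?n / \<delta>))))"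
      using t r by (simp add: ennreal_mult' mult_left_mono)
    moreover have "q ^ m = 2 powr ((1 - p * ?n / \<delta>) * real m)"
      using q by (simp add: powr_realpow[symmetric] q_def powr_powr)
    then have "q ^ m = 2 ^ m * 2 powr (- (real m * p * ?n / \<delta>))"
      by (simp add: powr_realpow[symmetric] powr_add[symmetric] algebra_simps)
    then have "t * (r ^ CARD('n) * 2 powr (- (real m * p * ?n / \<delta>))) = T * r ^ CARD('n) * q ^ m"
      by (simp add: t_def mult_ac)
    ultimately show ?thesis by (simp only: t_def)
  qed
  have "(\<Sum>m. ennreal (T * 2 ^ m) * hausdorff_content ?n {y\<in>ball x r. ennreal (T * 2 ^ m) < g y})
      \<le> (\<Sum>m. ennreal (T * r ^ CARD('n) * q ^ m))"
    by (intro suminf_le lev) auto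
  also have "\<dots> = ennreal (T * r ^ CARD('n) * (1 / (1 - q)))"
    using T r q by (intro suminf_ennreal_eq sums_mult geometric_sums) auto
  finally have "choquet_integral (hausdorff_content ?n) (ball x r) g \<le>
      ennreal (T * r ^ CARD('n)) + ennreal (T * r ^ CARD('n) * (1 / (1 - q)))"
    using choquet_ball_le[OF T r, of x g] by (meson add_left_mono order_trans)
  also have "\<dots> = ennreal ((1 + 1 / (1 - q)) * (T * r ^ CARD('n)))"
    using T r q by (simp add: ennreal_plus[symmetric] algebra_simps del: ennreal_plus)
  finally show ?thesis .
qed

section \<open>Weak type estimate at the critical exponent\<close>

lemma content_maximal_0_gtD:
  fixes f :: "real ^ 'n \<Rightarrow> ereal"
  assumes "ennreal s < content_maximal 0 f x" "s \<ge> 0"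
  obtains r where "r > 0"
    "ennreal (s * r ^ CARD('n)) < choquet_integral (hausdorff_content (real CARD('n))) (ball x r) (\<lambda>y. e2ennreal \<bar>f y\<bar>)"
proof -
  obtain r where r: "r > 0" and
    "ennreal s < ennreal (r powr 0) / hausdorff_content (real CARD('n)) (ball x r) *
      choquet_integral (hausdorff_content (real CARD('n))) (ball x r) (\<lambda>y. e2ennreal \<bar>f y\<bar>)"
    using assms(1) unfolding content_maximal_def less_SUP_iff by auto
  then have "ennreal s < ennreal (1 / r ^ CARD('n)) * choquet_integral (hausdorff_content (real CARD('n))) (ball x r) (\<lambda>y. e2ennreal \<bar>f y\<bar>)"
    by (simp add: content_ball divide_ennreal flip: ennreal_1)
  then have "ennreal (s * r ^ CARD('n)) < choquet_integral (hausdorff_content (real CARD('n))) (ball x r) (\<lambda>y. e2ennreal \<bar>f y\<bar>)"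
    using r assms(2) by (cases "choquet_integral (hausdorff_content (real CARD('n))) (ball x r) (\<lambda>y. e2ennreal \<bar>f y\<bar>)")
      (auto simp: ennreal_mult[symmetric] ennreal_less_iff field_simps)
  with r show ?thesis by (rule that)
qed

text \<open>The weak type estimate at the critical exponent \<open>\<delta> / n\<close>. Cover the level sets
  \<open>{\<bar>f\<bar> > 2\<^sup>m T}\<close> by balls \<open>B\<^sub>m\<^sub>j\<close> of radius \<open>s\<^sub>m\<^sub>j\<close>, almost optimally for the \<open>\<delta>\<close>-content. The tripled
  balls cover a set \<open>U\<close> of admissible content. If \<open>x\<close> lies outside \<open>U\<close>, then any \<open>B\<^sub>m\<^sub>j\<close> that meets
  \<open>ball x r\<close> is small and has its centre in \<open>ball x (2 * r)\<close>. So if the average over \<open>ball x r\<close>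
  exceeds \<open>2 T\<close>, then \<open>r\<^sup>n \<le> \<Sum> 2\<^sup>m s\<^sub>m\<^sub>j\<^sup>n\<close> over the centres in \<open>ball x (2 * r)\<close>, and the
  power \<open>\<delta> / n \<le> 1\<close> gives \<open>r\<^sup>\<delta> \<le> \<nu> (ball x (2 * r))\<close> for the discrete measure \<open>\<nu>\<close> with
  mass \<open>2\<^sup>m\<^sup>\<delta>\<^sup>/\<^sup>n s\<^sub>m\<^sub>j\<^sup>\<delta>\<close> at the centre of \<open>B\<^sub>m\<^sub>j\<close>. Being a measure, \<open>\<nu>\<close> is additive over the
  disjoint balls of a Vitali family, a property that the content itself lacks.\<close>

lemma maximal_weak_type:
  fixes f :: "real ^ 'n \<Rightarrow> ereal" and \<delta> T :: real
  assumes d: "0 < \<delta>" "\<delta> \<le> real CARD('n)" and T: "T > 0"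
  shows "hausdorff_content \<delta> {x. ennreal (2 * T) < content_maximal 0 f x} \<le>
    ennreal (3 powr \<delta> + 10 powr \<delta>) * (\<Sum>m. ennreal (2 powr (real m * \<delta> / real CARD('n))) *
      hausdorff_content \<delta> {x. ennreal (T * 2 ^ m) < e2ennreal \<bar>f x\<bar>})"
proof -
  let ?n = "real CARD('n)"
  define g where "g x = e2ennreal \<bar>f x\<bar>" for x
  define w where "w m = 2 powr (real m * \<delta> / ?n)" for m :: nat
  define h where "h m = hausdorff_content \<delta> {x. ennreal (T * 2 ^ m) < g x}" for m :: nat
  define R where "R = (\<Sum>m. ennreal (w m) * h m)"
  have w1: "w m \<ge> 1" for m using d by (auto simp: w_def intro!: ge_one_powr_ge_zero)
  have w0: "w m > 0" for m using w1[of m] by linarith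
  have main: "hausdorff_content \<delta> {x. ennreal (2 * T) < content_maximal 0 f x} \<le>
    ennreal (3 powr \<delta> + 10 powr \<delta>) * (R + ennreal e)" if e: "e > 0" and R: "R < top" for e
  proof -
    \<comment> \<open>The covering error at level \<open>m\<close> is chosen so that, weighted by \<open>w m\<close>, the errors sum to \<open>e\<close>.\<close>
    define Q where "Q m y s \<longleftrightarrow> (\<forall>j. s j \<ge> 0) \<and> {x. ennreal (T * 2 ^ m) < g x} \<subseteq> (\<Union>j::nat. ball (y j) (s j)) \<and>
        (\<integral>\<^sup>+j. ennreal (s j powr \<delta>) \<partial>count_space UNIV) < h m + ennreal (e * (1 / 2) ^ Suc m / w m)" for m y s
    have "\<exists>y s. Q m y s" for m
    proof -
      have "ennreal (w m) * h m \<le> R" unfolding R_def by (rule suminf_ge_term)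
      then have "ennreal (w m) * h m < top" using R by (rule le_less_trans)
      then have "h m < top" using w0[of m] by (auto simp: ennreal_mult_less_top)
      then have "h m < h m + ennreal (e * (1 / 2) ^ Suc m / w m)"
        using e w0[of m] by (intro ennreal_add_less_self) auto
      then obtain y s where "\<And>j. s j \<ge> 0" "{x. ennreal (T * 2 ^ m) < g x} \<subseteq> (\<Union>j::nat. ball (y j) (s j))"
        "(\<integral>\<^sup>+j. ennreal (s j powr \<delta>) \<partial>count_space UNIV) < h m + ennreal (e * (1 / 2) ^ Suc m / w m)"
        unfolding h_def by (rule content_cover) blast
      then show ?thesis by (intro exI[of _ y] exI[of _ s]) (simp add: Q_def)
    qed
    then obtain y s where Q: "\<And>m. Q m (y m) (s m)" by metis
    have s0: "s m j \<ge> 0" for m j using Q by (simp add: Q_def)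
    have cover: "{x. ennreal (T * 2 ^ m) < g x} \<subseteq> (\<Union>j. ball (y m j) (s m j))" for m
      using Q by (simp add: Q_def)
    have cost: "(\<integral>\<^sup>+j. ennreal (s m j powr \<delta>) \<partial>count_space UNIV) < h m + ennreal (e * (1 / 2) ^ Suc m / w m)" for m
      using Q by (simp add: Q_def)
    define a where "a = (\<lambda>(m, j). w m * s m j powr \<delta>)"
    have a0: "a i \<ge> 0" for i using less_imp_le[OF w0] by (auto simp: a_def split: prod.splits)
    define S where "S = (\<integral>\<^sup>+i. ennreal (a i) \<partial>count_space UNIV)"
    have "S = (\<integral>\<^sup>+m. \<integral>\<^sup>+j. ennreal (a (m, j)) \<partial>count_space UNIV \<partial>count_space UNIV)"
      unfolding S_def by (rule nn_integral_fst_count_space[symmetric])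
    also have "\<dots> = (\<Sum>m. ennreal (w m) * (\<integral>\<^sup>+j. ennreal (s m j powr \<delta>) \<partial>count_space UNIV))"
      unfolding nn_integral_count_space_nat[of "\<lambda>m. integral\<^sup>N (count_space UNIV) (F m)" for F]
      using w0 by (simp add: a_def ennreal_mult less_imp_le nn_integral_cmult)
    also have "\<dots> \<le> (\<Sum>m. ennreal (w m) * h m + ennreal (e * (1 / 2) ^ Suc m))"
    proof (intro suminf_le summableI)
      fix m
      have "ennreal (w m) * (\<integral>\<^sup>+j. ennreal (s m j powr \<delta>) \<partial>count_space UNIV) \<le>
          ennreal (w m) * (h m + ennreal (e * (1 / 2) ^ Suc m / w m))"
        by (rule mult_left_mono[OF less_imp_le[OF cost]]) simp
      also have "\<dots> = ennreal (w m) * h m + ennreal (e * (1 / 2) ^ Suc m)"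
        using w0[of m] e by (simp add: distrib_left ennreal_mult[symmetric])
      finally show "ennreal (w m) * (\<integral>\<^sup>+j. ennreal (s m j powr \<delta>) \<partial>count_space UNIV) \<le> \<dots>" .
    qed
    also have "\<dots> = R + (\<Sum>m. ennreal (e * (1 / 2) ^ Suc m))"
      unfolding R_def by (rule suminf_add[symmetric]) auto
    also have "(\<Sum>m. ennreal (e * (1 / 2) ^ Suc m)) = ennreal (e * 1)"
      using e by (intro suminf_ennreal_eq sums_mult power_half_series) auto
    finally have S: "S \<le> R + ennreal e" by simp
    then have "S < top" using R by (auto intro: le_less_trans)
    then obtain c where c: "c \<ge> 0" "S = ennreal c" by (cases S) auto
    define U where "U = (\<Union>(m, j). ball (y m j) (3 * s m j))"
    have "hausdorff_content \<delta> U \<le> (\<integral>\<^sup>+i. ennreal ((case i of (m, j) \<Rightarrow> 3 * s m j) powr \<delta>) \<partial>count_space UNIV)"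
      unfolding U_def by (rule content_le_cover[where x="\<lambda>(m, j). y m j"]) auto
    also have "\<dots> \<le> (\<integral>\<^sup>+i. ennreal (3 powr \<delta>) * ennreal (a i) \<partial>count_space UNIV)"
    proof (intro nn_integral_mono)
      fix i :: "nat \<times> nat"
      obtain m j where i: "i = (m, j)" by (cases i)
      have "(3 * s m j) powr \<delta> \<le> 3 powr \<delta> * a i"
        using w1[of m] s0[of m j] by (simp add: i a_def powr_mult mult_le_cancel_right1)
      then show "ennreal ((case i of (m, j) \<Rightarrow> 3 * s m j) powr \<delta>) \<le> ennreal (3 powr \<delta>) * ennreal (a i)"
        using a0[of i] by (simp add: i ennreal_mult[symmetric] ennreal_leI)
    qed
    also have "\<dots> = ennreal (3 powr \<delta>) * S"
      unfolding S_def by (rule nn_integral_cmult) simp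
    finally have U: "hausdorff_content \<delta> U \<le> ennreal (3 powr \<delta>) * S" .
    define V where "V = {x. ennreal (2 * T) < content_maximal 0 f x} - U"
    define \<nu> where "\<nu> A = (\<integral>\<^sup>+i. ennreal (a i) * indicator A (case i of (m, j) \<Rightarrow> y m j) \<partial>count_space UNIV)" for A
    have "\<exists>r>0. ennreal (r powr \<delta>) \<le> \<nu> (ball x (2 * r))" if x: "x \<in> V" for x
    proof -
      obtain r where r: "r > 0" and big: "ennreal (2 * T * r ^ CARD('n)) <
          choquet_integral (hausdorff_content ?n) (ball x r) g"
        using x T unfolding V_def g_def by (auto elim: content_maximal_0_gtD)
      define I where "I = {i. (case i of (m, j) \<Rightarrow> y m j) \<in> ball x (2 * r)}"
      have lev: "hausdorff_content ?n {z\<in>ball x r. ennreal (T * 2 ^ m) < g z} \<le>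
          (\<integral>\<^sup>+j. ennreal (s m j powr ?n) * indicator I (m, j) \<partial>count_space UNIV)" for m
      proof -
        have "hausdorff_content ?n {z\<in>ball x r. ennreal (T * 2 ^ m) < g z} \<le>
          (\<integral>\<^sup>+j. ennreal (s m j powr ?n) \<partial>count_space {j. (m, j) \<in> I})"
        proof (rule content_le_cover)
          show "{z\<in>ball x r. ennreal (T * 2 ^ m) < g z} \<subseteq> (\<Union>j\<in>{j. (m, j) \<in> I}. ball (y m j) (s m j))"
          proof
            fix z assume z: "z \<in> {z\<in>ball x r. ennreal (T * 2 ^ m) < g z}"
            then obtain j where j: "z \<in> ball (y m j) (s m j)" using cover[of m] by blast
            have "x \<notin> ball (y m j) (3 * s m j)" using x by (auto simp: V_def U_def)
            with j z dist_triangle[of x "y m j" z] have "dist x (y m j) < 2 * r"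
              using s0[of m j] by (auto simp: dist_commute)
            then show "z \<in> (\<Union>j\<in>{j. (m, j) \<in> I}. ball (y m j) (s m j))"
              using j by (auto simp: I_def)
          qed
        qed simp
        also have "\<dots> = (\<integral>\<^sup>+j. ennreal (s m j powr ?n) * indicator I (m, j) \<partial>count_space UNIV)"
          by (subst nn_integral_count_space_indicator) (auto intro!: nn_integral_cong split: split_indicator)
        finally show ?thesis .
      qed
      \<comment> \<open>The part of the integral below height \<open>T\<close> accounts for at most half of \<open>2 * T * r ^ n\<close>.\<close>
      have "\<not> (\<Sum>m. ennreal (T * 2 ^ m) * hausdorff_content ?n {z\<in>ball x r. ennreal (T * 2 ^ m) < g z})
          \<le> ennreal (T * r ^ CARD('n))"
      proof
        assume "(\<Sum>m. ennreal (T * 2 ^ m) * hausdorff_content ?n {z\<in>ball x r. ennreal (T * 2 ^ m) < g z})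
          \<le> ennreal (T * r ^ CARD('n))"
        then have "choquet_integral (hausdorff_content ?n) (ball x r) g
            \<le> ennreal (T * r ^ CARD('n)) + ennreal (T * r ^ CARD('n))"
          using choquet_ball_le[OF T r, of x g] by (meson add_left_mono order_trans)
        also have "\<dots> = ennreal (2 * T * r ^ CARD('n))"
          using T r by (simp add: ennreal_plus[symmetric] del: ennreal_plus)
        finally show False using big by simp
      qed
      then have "ennreal (T * r ^ CARD('n)) <
          (\<Sum>m. ennreal (T * 2 ^ m) * hausdorff_content ?n {z\<in>ball x r. ennreal (T * 2 ^ m) < g z})"
        by simp
      also have "\<dots> \<le> (\<Sum>m. ennreal (T * 2 ^ m) * (\<integral>\<^sup>+j. ennreal (s m j powr ?n) * indicator I (m, j) \<partial>count_space UNIV))"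
        by (intro suminf_le summableI mult_left_mono lev) auto
      also have "\<dots> = (\<integral>\<^sup>+m. ennreal (T * 2 ^ m) * (\<integral>\<^sup>+j. ennreal (s m j powr ?n) * indicator I (m, j) \<partial>count_space UNIV) \<partial>count_space UNIV)"
        by (rule nn_integral_count_space_nat[symmetric])
      also have "\<dots> = (\<integral>\<^sup>+m. \<integral>\<^sup>+j. ennreal T * (ennreal (a (m, j) powr (?n / \<delta>)) * indicator I (m, j)) \<partial>count_space UNIV \<partial>count_space UNIV)"
      proof (intro nn_integral_cong)
        fix m
        have "a (m, j) powr (?n / \<delta>) = 2 ^ m * s m j powr ?n" for j
          using d s0 by (simp add: a_def w_def powr_mult powr_powr powr_realpow)
        then show "ennreal (T * 2 ^ m) * (\<integral>\<^sup>+j. ennreal (s m j powr ?n) * indicator I (m, j) \<partial>count_space UNIV) =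
          (\<integral>\<^sup>+j. ennreal T * (ennreal (a (m, j) powr (?n / \<delta>)) * indicator I (m, j)) \<partial>count_space UNIV)"
          using T by (simp add: nn_integral_cmult[symmetric] ennreal_mult mult.assoc)
      qed
      also have "\<dots> = (\<integral>\<^sup>+i. ennreal T * (ennreal (a i powr (?n / \<delta>)) * indicator I i) \<partial>count_space UNIV)"
        by (rule nn_integral_fst_count_space)
      also have "\<dots> = ennreal T * (\<integral>\<^sup>+i. ennreal (a i powr (?n / \<delta>)) \<partial>count_space I)"
        by (simp add: nn_integral_cmult nn_integral_count_space_indicator[of I])
      finally have less: "ennreal (T * r ^ CARD('n)) < ennreal T * (\<integral>\<^sup>+i. ennreal (a i powr (?n / \<delta>)) \<partial>count_space I)" .
      have \<nu>_eq: "\<nu> (ball x (2 * r)) = (\<integral>\<^sup>+i. ennreal (a i) \<partial>count_space I)"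
        unfolding \<nu>_def by (subst nn_integral_count_space_indicator) (auto intro!: nn_integral_cong simp: I_def split: split_indicator)
      also have "\<dots> \<le> S" unfolding S_def by (rule nn_integral_count_space_mono) simp
      finally obtain b where b: "b \<ge> 0" "\<nu> (ball x (2 * r)) = ennreal b"
        using \<open>S < top\<close> by (cases "\<nu> (ball x (2 * r))") (auto simp: top_unique)
      have "(\<integral>\<^sup>+i. ennreal (a i powr (?n / \<delta>)) \<partial>count_space I) \<le> ennreal (b powr (?n / \<delta>))"
        using a0 d b \<nu>_eq by (intro nn_integral_powr_le) auto
      then have "ennreal T * (\<integral>\<^sup>+i. ennreal (a i powr (?n / \<delta>)) \<partial>count_space I) \<le> ennreal (T * b powr (?n / \<delta>))"
        using T by (simp add: ennreal_mult mult_left_mono)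
      with less have "ennreal (T * r ^ CARD('n)) < ennreal (T * b powr (?n / \<delta>))"
        by (rule less_le_trans)
      then have "r powr ?n < b powr (?n / \<delta>)"
        using T r by (simp add: ennreal_less_iff powr_realpow)
      then have "(r powr ?n) powr (\<delta> / ?n) \<le> (b powr (?n / \<delta>)) powr (\<delta> / ?n)"
        using d by (intro powr_mono2) auto
      then have "r powr \<delta> \<le> b" using d b by (simp add: powr_powr)
      with r b show ?thesis by (auto intro: ennreal_leI)
    qed
    then obtain \<rho> where \<rho>0: "\<And>x. x \<in> V \<Longrightarrow> \<rho> x > 0"
      and \<rho>: "\<And>x. x \<in> V \<Longrightarrow> ennreal (\<rho> x powr \<delta>) \<le> \<nu> (ball x (2 * \<rho> x))"
      by metis
    \<comment> \<open>The total mass of \<open>\<nu>\<close> is finite, so the radii are bounded, as the Vitali lemma requires.\<close>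
    have bound: "\<rho> x \<le> c powr (1 / \<delta>)" if x: "x \<in> V" for x
    proof -
      have "\<nu> (ball x (2 * \<rho> x)) \<le> S"
        unfolding \<nu>_def S_def by (intro nn_integral_mono) (auto split: split_indicator)
      with \<rho>[OF x] c have "\<rho> x powr \<delta> \<le> c" by (metis order_trans ennreal_le_iff)
      then have "(\<rho> x powr \<delta>) powr (1 / \<delta>) \<le> c powr (1 / \<delta>)" using d by (intro powr_mono2) auto
      then show ?thesis using d \<rho>0[OF x] by (simp add: powr_powr)
    qed
    have "V \<subseteq> (\<Union>x\<in>V. ball x (2 * \<rho> x))" using \<rho>0 by force
    moreover have "0 < 2 * \<rho> x \<and> 2 * \<rho> x \<le> 2 * c powr (1 / \<delta>)" if "x \<in> V" for x
      using \<rho>0[OF that] bound[OF that] by simp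
    ultimately obtain C where C: "countable C" "C \<subseteq> V"
      and disj: "pairwise (\<lambda>x z. disjnt (ball x (2 * \<rho> x)) (ball z (2 * \<rho> z))) C"
      and VC: "V \<subseteq> (\<Union>x\<in>C. ball x (5 * (2 * \<rho> x)))"
      by (rule Vitali_covering_lemma_balls)
    have "hausdorff_content \<delta> V \<le> (\<integral>\<^sup>+x. ennreal ((5 * (2 * \<rho> x)) powr \<delta>) \<partial>count_space C)"
      by (rule content_le_cover[OF C(1) VC])
    also have "\<dots> \<le> (\<integral>\<^sup>+x. ennreal (10 powr \<delta>) * \<nu> (ball x (2 * \<rho> x)) \<partial>count_space C)"
    proof (intro nn_integral_mono)
      fix x assume "x \<in> space (count_space C)"
      then have x: "x \<in> V" using C by auto
      have "ennreal ((5 * (2 * \<rho> x)) powr \<delta>) = ennreal (10 powr \<delta>) * ennreal (\<rho> x powr \<delta>)"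
        using \<rho>0[OF x] by (simp add: ennreal_mult[symmetric] powr_mult[symmetric])
      then show "ennreal ((5 * (2 * \<rho> x)) powr \<delta>) \<le> ennreal (10 powr \<delta>) * \<nu> (ball x (2 * \<rho> x))"
        using \<rho>[OF x] by (simp add: mult_left_mono)
    qed
    also have "\<dots> = ennreal (10 powr \<delta>) * (\<integral>\<^sup>+x. \<nu> (ball x (2 * \<rho> x)) \<partial>count_space C)"
      by (rule nn_integral_cmult) simp
    also have "(\<integral>\<^sup>+x. \<nu> (ball x (2 * \<rho> x)) \<partial>count_space C) =
      (\<integral>\<^sup>+i. \<integral>\<^sup>+x. ennreal (a i) * indicator (ball x (2 * \<rho> x)) (case i of (m, j) \<Rightarrow> y m j) \<partial>count_space C \<partial>count_space UNIV)"
      unfolding \<nu>_def using C(1) by (intro nn_integral_count_space_nn_integral[symmetric]) auto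
    also have "\<dots> \<le> S"
      unfolding S_def
    proof (intro nn_integral_mono)
      fix i
      let ?y = "case i of (m, j) \<Rightarrow> y m j"
      have "(\<integral>\<^sup>+x. indicator (ball x (2 * \<rho> x)) ?y \<partial>count_space C) \<le> (1::ennreal)"
      proof (cases "\<exists>x\<in>C. ?y \<in> ball x (2 * \<rho> x)")
        case True
        then obtain x where x: "x \<in> C" "?y \<in> ball x (2 * \<rho> x)" by blast
        have "?y \<notin> ball z (2 * \<rho> z)" if "z \<in> C" "z \<noteq> x" for z
          using disj x that unfolding pairwise_def disjnt_def by blast
        then have "(\<integral>\<^sup>+x. indicator (ball x (2 * \<rho> x)) ?y \<partial>count_space C) = (\<integral>\<^sup>+z. indicator (ball z (2 * \<rho> z)) ?y \<partial>count_space {x} :: ennreal)"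
          using x by (intro nn_integral_count_space_eq) (auto split: split_indicator)
        also have "\<dots> \<le> 1" by (subst nn_integral_count_space_finite) (auto split: split_indicator)
        finally show ?thesis .
      next
        case False
        then have "(\<integral>\<^sup>+x. indicator (ball x (2 * \<rho> x)) ?y \<partial>count_space C) = (\<integral>\<^sup>+x. 0 \<partial>count_space C :: ennreal)"
          by (intro nn_integral_cong) (auto split: split_indicator)
        then show ?thesis by simp
      qed
      then show "(\<integral>\<^sup>+x. ennreal (a i) * indicator (ball x (2 * \<rho> x)) ?y \<partial>count_space C) \<le> ennreal (a i)"
        by (subst nn_integral_cmult) (auto simp: mult_left_le)
    qed
    finally have V: "hausdorff_content \<delta> V \<le> ennreal (10 powr \<delta>) * S" by (simp add: mult_left_mono)
    have "hausdorff_content \<delta> {x. ennreal (2 * T) < content_maximal 0 f x} \<le> hausdorff_content \<delta> (U \<union> V)"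
      by (rule content_mono) (auto simp: V_def)
    also have "\<dots> \<le> ennreal (3 powr \<delta>) * S + ennreal (10 powr \<delta>) * S"
      by (rule order_trans[OF content_Un add_mono[OF U V]])
    also have "\<dots> = ennreal (3 powr \<delta> + 10 powr \<delta>) * S"
      by (simp add: distrib_right)
    also have "\<dots> \<le> ennreal (3 powr \<delta> + 10 powr \<delta>) * (R + ennreal e)"
      by (intro mult_left_mono S) simp
    finally show ?thesis .
  qed
  have "hausdorff_content \<delta> {x. ennreal (2 * T) < content_maximal 0 f x} \<le> ennreal (3 powr \<delta> + 10 powr \<delta>) * R"
  proof (cases "R = top")
    case True
    have "3 powr \<delta> + 10 powr \<delta> > 0" by (simp add: add_pos_pos)
    with True show ?thesis by (simp add: ennreal_mult_top)
  next
    case False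
    show ?thesis
    proof (rule ennreal_le_epsilon)
      fix e :: real assume "e > 0"
      define K where "K = 3 powr \<delta> + 10 powr \<delta>"
      have K: "K > 0" by (simp add: K_def add_pos_pos)
      have "hausdorff_content \<delta> {x. ennreal (2 * T) < content_maximal 0 f x} \<le> ennreal K * (R + ennreal (e / K))"
        unfolding K_def by (rule main) (use \<open>e > 0\<close> K False in \<open>auto simp: K_def less_top\<close>)
      also have "\<dots> = ennreal K * R + ennreal e"
        using K \<open>e > 0\<close> by (simp add: distrib_left ennreal_mult[symmetric])
      finally show "hausdorff_content \<delta> {x. ennreal (2 * T) < content_maximal 0 f x} \<le>
          ennreal (3 powr \<delta> + 10 powr \<delta>) * R + ennreal e" by (simp add: K_def)
    qed
  qed
  then show ?thesis by (simp add: R_def h_def g_def w_def)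
qed

section \<open>Strong type estimate for the nonfractional maximal function\<close>

text \<open>The substitution \<open>t \<mapsto> l t\<close> in the Choquet integral.\<close>

lemma choquet_dilation:
  assumes l: "l > 0"
  shows "(\<integral>\<^sup>+t\<in>{0..}. hausdorff_content \<delta> {x. ennreal (l * t) < g x} \<partial>lborel) =
    ennreal (1 / l) * choquet_integral (hausdorff_content \<delta>) UNIV g"
proof -
  have [measurable]: "(\<lambda>t. hausdorff_content \<delta> {x. ennreal t < g x}) \<in> borel_measurable borel"
    using borel_content_level[of \<delta> UNIV g] by simp
  have "choquet_integral (hausdorff_content \<delta>) UNIV g =
      ennreal l * (\<integral>\<^sup>+t. hausdorff_content \<delta> {x. ennreal (l * t) < g x} * indicator {0..} (l * t) \<partial>lborel)"
    unfolding choquet_integral_def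
    using l by (subst nn_integral_real_affine[where c=l and t=0]) auto
  also have "(\<lambda>t. indicator {0..} (l * t) :: ennreal) = indicator {0..}"
    using l by (auto simp: fun_eq_iff zero_le_mult_iff split: split_indicator)
  then have "(\<integral>\<^sup>+t. hausdorff_content \<delta> {x. ennreal (l * t) < g x} * indicator {0..} (l * t) \<partial>lborel) =
      (\<integral>\<^sup>+t\<in>{0..}. hausdorff_content \<delta> {x. ennreal (l * t) < g x} \<partial>lborel)"
    by (simp add: fun_eq_iff)
  finally show ?thesis
    using l by (simp add: mult.assoc[symmetric] ennreal_mult'[symmetric])
qed

lemma choquet_mono:
  "(\<And>x. g x \<le> h x) \<Longrightarrow> choquet_integral (hausdorff_content \<delta>) \<Omega> g \<le> choquet_integral (hausdorff_content \<delta>) \<Omega> h"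
  unfolding choquet_integral_def
  by (intro nn_integral_mono mult_right_mono content_mono) (auto intro: less_le_trans)

lemma choquet_cmult:
  assumes c: "c > 0"
  shows "choquet_integral (hausdorff_content \<delta>) UNIV (\<lambda>x. ennreal c * g x) =
    ennreal c * choquet_integral (hausdorff_content \<delta>) UNIV g"
proof -
  have "ennreal t < ennreal c * g x \<longleftrightarrow> ennreal ((1 / c) * t) < g x" if "t \<ge> 0" for t x
    using c that by (cases "g x") (auto simp: ennreal_mult[symmetric] ennreal_less_iff field_simps ennreal_mult_top)
  then have "choquet_integral (hausdorff_content \<delta>) UNIV (\<lambda>x. ennreal c * g x) =
      (\<integral>\<^sup>+t\<in>{0..}. hausdorff_content \<delta> {x. ennreal ((1 / c) * t) < g x} \<partial>lborel)"
    unfolding choquet_integral_def by (intro nn_integral_cong) (auto split: split_indicator)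
  also have "\<dots> = ennreal c * choquet_integral (hausdorff_content \<delta>) UNIV g"
    using c by (subst choquet_dilation) auto
  finally show ?thesis .
qed

text \<open>The strong type estimate for \<open>\<kappa> = 0\<close>: at height \<open>t\<close> the weak type estimate is applied with
  \<open>2 T = t\<^sup>1\<^sup>/\<^sup>p\<close>. Integration in \<open>t\<close> turns the \<open>m\<close>-th level set into a multiple
  \<open>2\<^sup>p 2\<^sup>-\<^sup>m\<^sup>p\<close> of the full Choquet integral of \<open>\<bar>f\<bar>\<^sup>p\<close>, and
  \<open>\<Sum> 2\<^sup>m\<^sup>\<delta>\<^sup>/\<^sup>n 2\<^sup>-\<^sup>m\<^sup>p\<close> converges because \<open>p > \<delta> / n\<close>.\<close>

lemma maximal_strong_type:
  fixes \<delta> p :: real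
  assumes d: "0 < \<delta>" "\<delta> \<le> real CARD('n)" and p: "\<delta> / real CARD('n) < p"
  obtains A :: real where "A > 0" "\<And>f :: real ^ 'n \<Rightarrow> ereal.
    choquet_integral (hausdorff_content \<delta>) UNIV (\<lambda>x. ennreal_powr (content_maximal 0 f x) p) \<le>
    ennreal A * choquet_integral (hausdorff_content \<delta>) UNIV (\<lambda>x. ennreal_powr (e2ennreal \<bar>f x\<bar>) p)"
proof -
  let ?n = "real CARD('n)"
  define K where "K = 3 powr \<delta> + 10 powr \<delta>"
  have K: "K > 0" by (simp add: K_def add_pos_pos)
  define q where "q = 2 powr (\<delta> / ?n - p)"
  have q: "0 < q" "q < 1" unfolding q_def using p powr_less_mono[of "\<delta> / ?n - p" 0 2] by auto
  have p0: "p > 0" by (rule supercritical_exponent(1)[OF d(1) p])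
  define w where "w m = 2 powr (real m * \<delta> / ?n)" for m :: nat
  define l where "l m = (2 ^ m / 2) powr p" for m :: nat
  have l0: "l m > 0" for m by (simp add: l_def)
  have wl: "w m * (1 / l m) = 2 powr p * q ^ m" for m
  proof -
    have "q ^ m = 2 powr ((\<delta> / ?n - p) * real m)"
      using q by (simp add: powr_realpow[symmetric] q_def powr_powr)
    then show ?thesis
      by (simp add: w_def l_def powr_divide powr_realpow[symmetric] powr_powr powr_add[symmetric]
          powr_diff[symmetric] algebra_simps)
  qed
  show ?thesis
  proof (rule that)
    show "K * (2 powr p * (1 / (1 - q))) > 0" using K q by simp
    fix f :: "real ^ 'n \<Rightarrow> ereal"
    define g where "g x = ennreal_powr (e2ennreal \<bar>f x\<bar>) p" for x
    have meas [measurable]: "(\<lambda>t. hausdorff_content \<delta> {x. ennreal (l m * t) < g x}) \<in> borel_measurable borel" for m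
    proof -
      have "(\<lambda>t. hausdorff_content \<delta> {x. ennreal t < g x}) \<in> borel_measurable borel"
        using borel_content_level[of \<delta> UNIV g] by simp
      then show ?thesis by (rule measurable_compose[rotated]) simp
    qed
    have pw: "hausdorff_content \<delta> {x. ennreal t < ennreal_powr (content_maximal 0 f x) p} \<le>
        ennreal K * (\<Sum>m. ennreal (w m) * hausdorff_content \<delta> {x. ennreal (l m * t) < g x})" if t: "t > 0" for t
    proof -
      define T where "T = t powr (1 / p) / 2"
      have T: "T > 0" using t by (simp add: T_def)
      have tT: "t = (2 * T) powr p" using t p0 by (simp add: T_def powr_powr)
      have lt: "l m * t = (T * 2 ^ m) powr p" for m
        using T by (simp add: l_def tT powr_mult[symmetric] mult.commute)
      have e1: "{x. ennreal t < ennreal_powr (content_maximal 0 f x) p} = {x. ennreal (2 * T) < content_maximal 0 f x}"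
        unfolding tT using T p0 by (subst less_ennreal_powr_iff) auto
      have e2: "{x. ennreal (l m * t) < g x} = {x. ennreal (T * 2 ^ m) < e2ennreal \<bar>f x\<bar>}" for m
        unfolding lt g_def using T p0 by (subst less_ennreal_powr_iff) auto
      show ?thesis
        unfolding e1 e2 K_def w_def by (rule maximal_weak_type[OF d T])
    qed
    have "choquet_integral (hausdorff_content \<delta>) UNIV (\<lambda>x. ennreal_powr (content_maximal 0 f x) p) \<le>
      (\<integral>\<^sup>+t. ennreal K * (\<Sum>m. ennreal (w m) * (hausdorff_content \<delta> {x. ennreal (l m * t) < g x} * indicator {0..} t)) \<partial>lborel)"
      unfolding choquet_integral_def
      \<comment> \<open>The point \<open>t = 0\<close>, at which the weak type estimate says nothing, is a null set.\<close>
    proof (rule nn_integral_mono_AE)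
      have "hausdorff_content \<delta> {x \<in> UNIV. ennreal t < ennreal_powr (content_maximal 0 f x) p} * indicator {0..} t \<le>
          ennreal K * (\<Sum>m. ennreal (w m) * (hausdorff_content \<delta> {x. ennreal (l m * t) < g x} * indicator {0..} t))"
        if "t \<noteq> 0" for t
        using pw[of t] that by (cases "t > 0") auto
      with AE_lborel_singleton[of 0] show "AE t in lborel. hausdorff_content \<delta> {x \<in> UNIV. ennreal t < ennreal_powr (content_maximal 0 f x) p} * indicator {0..} t \<le>
          ennreal K * (\<Sum>m. ennreal (w m) * (hausdorff_content \<delta> {x. ennreal (l m * t) < g x} * indicator {0..} t))"
        by (auto elim!: eventually_mono)
    qed
    also have "\<dots> = ennreal K * (\<Sum>m. ennreal (w m) * (\<integral>\<^sup>+t\<in>{0..}. hausdorff_content \<delta> {x. ennreal (l m * t) < g x} \<partial>lborel))"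
      by (simp add: nn_integral_cmult nn_integral_suminf del: ennreal_suminf_cmult)
    also have "\<dots> = ennreal K * (\<Sum>m. ennreal (2 powr p * q ^ m) * choquet_integral (hausdorff_content \<delta>) UNIV g)"
      unfolding choquet_dilation[OF l0] wl[symmetric]
      using less_imp_le[OF l0] by (simp only: ennreal_mult'' mult.assoc zero_le_divide_1_iff)
    also have "\<dots> = ennreal K * ((\<Sum>m. ennreal (2 powr p * q ^ m)) * choquet_integral (hausdorff_content \<delta>) UNIV g)"
      by simp
    also have "(\<Sum>m. ennreal (2 powr p * q ^ m)) = ennreal (2 powr p * (1 / (1 - q)))"
      using q by (intro suminf_ennreal_eq sums_mult geometric_sums) auto
    also have "ennreal K * (ennreal (2 powr p * (1 / (1 - q))) * choquet_integral (hausdorff_content \<delta>) UNIV g) =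
        ennreal (K * (2 powr p * (1 / (1 - q)))) * choquet_integral (hausdorff_content \<delta>) UNIV g"
      using K q by (subst ennreal_mult) (auto simp only: mult.assoc, auto)
    finally show "choquet_integral (hausdorff_content \<delta>) UNIV (\<lambda>x. ennreal_powr (content_maximal 0 f x) p) \<le>
        ennreal (K * (2 powr p * (1 / (1 - q)))) * choquet_integral (hausdorff_content \<delta>) UNIV (\<lambda>x. ennreal_powr (e2ennreal \<bar>f x\<bar>) p)"
      unfolding g_def .
  qed
qed

section \<open>Fractional maximal functions\<close>

text \<open>Hedberg's inequality. The average \<open>a\<close> over a ball of radius \<open>r\<close> is bounded both by \<open>u\<close> and by
  \<open>D G\<^sup>1\<^sup>/\<^sup>p r\<^sup>-\<^sup>\<delta>\<^sup>/\<^sup>p\<close>. In the geometric mean with weights \<open>1 - \<theta>\<close> and \<open>\<theta>\<close> the powers of \<open>r\<close>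
  are \<open>r\<^sup>\<kappa> r\<^sup>-\<^sup>\<delta>\<^sup>\<theta>\<^sup>/\<^sup>p = 1\<close>, so no choice of \<open>r\<close> is needed. For \<open>\<kappa> = 0\<close> the right side is \<open>u\<close>.\<close>

lemma content_maximal_le_Hedberg:
  fixes f :: "real ^ 'n \<Rightarrow> ereal" and \<delta> \<kappa> p G u :: real
  defines "D \<equiv> 1 + 1 / (1 - 2 powr (1 - p * real CARD('n) / \<delta>))" and "\<theta> \<equiv> p * \<kappa> / \<delta>"
  assumes d: "0 < \<delta>" "\<delta> \<le> real CARD('n)" and p: "\<delta> / real CARD('n) < p"
    and k: "0 \<le> \<kappa>" "p * \<kappa> < \<delta>"
    and G: "choquet_integral (hausdorff_content \<delta>) UNIV (\<lambda>x. ennreal_powr (e2ennreal \<bar>f x\<bar>) p) \<le> ennreal G" "G > 0"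
    and u: "content_maximal 0 f x \<le> ennreal u" "u \<ge> 0"
  shows "content_maximal \<kappa> f x \<le> ennreal ((D * G powr (1 / p)) powr \<theta> * u powr (1 - \<theta>))"
  unfolding content_maximal_def
proof (intro SUP_least)
  fix r :: real assume "r \<in> {0<..}"
  then have r: "r > 0" by simp
  let ?n = "real CARD('n)"
  let ?I = "choquet_integral (hausdorff_content ?n) (ball x r) (\<lambda>y. e2ennreal \<bar>f y\<bar>)"
  have p0: "p > 0" by (rule supercritical_exponent(1)[OF d(1) p])
  have D: "D > 0"
    using supercritical_exponent(2)[OF d(1) p] by (simp add: D_def add_pos_pos)
  have \<theta>: "0 \<le> \<theta>" "\<theta> < 1" using k d p0 by (auto simp: \<theta>_def)
  define T where "T = (G * r powr (- \<delta>)) powr (1 / p)"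
  have T: "T > 0" using G r by (simp add: T_def)
  have "T powr p = G * r powr (- \<delta>)" using G r p0 by (simp add: T_def powr_powr)
  then have GT: "G = T powr p * r powr \<delta>" using r by (simp add: powr_minus)
  have I: "?I \<le> ennreal (D * (T * r ^ CARD('n)))"
    unfolding D_def by (rule choquet_ball_le_powr[OF d p T r G(1)]) (use G GT in auto)
  then obtain b where b: "b \<ge> 0" "?I = ennreal b" by (cases ?I) (auto simp: top_unique)
  define a where "a = b / r ^ CARD('n)"
  have a0: "a \<ge> 0" using b r by (simp add: a_def)
  have aD: "a \<le> D * T" using I b D T r by (simp add: a_def field_simps)
  have val: "ennreal (r powr \<epsilon>) / hausdorff_content ?n (ball x r) * ?I = ennreal (r powr \<epsilon> * a)" for \<epsilon>
    using r b by (simp add: content_ball divide_ennreal ennreal_mult'[symmetric] a_def)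
  have "ennreal (r powr 0) / hausdorff_content ?n (ball x r) * ?I \<le> content_maximal 0 f x"
    unfolding content_maximal_def using r by (intro SUP_upper) simp
  with u have "ennreal (r powr 0 * a) \<le> ennreal u" unfolding val by (blast intro: order_trans)
  then have au: "a \<le> u" using r u by simp
  have "r powr \<kappa> * a \<le> (D * G powr (1 / p)) powr \<theta> * u powr (1 - \<theta>)"
  proof (cases "a = 0")
    case False
    with a0 have "a = a powr \<theta> * a powr (1 - \<theta>)" by (simp add: powr_add[symmetric])
    also have "\<dots> \<le> (D * T) powr \<theta> * u powr (1 - \<theta>)"
      using a0 aD au \<theta> by (intro mult_mono powr_mono2) auto
    also have "D * T = (D * G powr (1 / p)) * r powr (- \<delta> / p)"
      using G r by (simp add: T_def powr_mult powr_powr)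
    also have "((D * G powr (1 / p)) * r powr (- \<delta> / p)) powr \<theta> = (D * G powr (1 / p)) powr \<theta> * r powr (- \<kappa>)"
      using D G r d p0 by (subst powr_mult) (auto simp: powr_powr \<theta>_def)
    finally have "r powr \<kappa> * a \<le> r powr \<kappa> * ((D * G powr (1 / p)) powr \<theta> * r powr (- \<kappa>) * u powr (1 - \<theta>))"
      by (rule mult_left_mono) simp
    also have "\<dots> = (D * G powr (1 / p)) powr \<theta> * u powr (1 - \<theta>)"
      using r by (simp add: powr_minus)
    finally show ?thesis .
  qed simp
  then show "ennreal (r powr \<kappa>) / hausdorff_content ?n (ball x r) * ?I
      \<le> ennreal ((D * G powr (1 / p)) powr \<theta> * u powr (1 - \<theta>))"
    unfolding val by (rule ennreal_leI)
qed

text \<open>The degenerate case \<open>G = 0\<close>, which the powers in Hedberg's inequality do not cover: every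
  average is at most a constant times \<open>T\<close> for all \<open>T > 0\<close>.\<close>

lemma content_maximal_eq_0:
  fixes f :: "real ^ 'n \<Rightarrow> ereal" and \<delta> \<kappa> p :: real
  assumes d: "0 < \<delta>" "\<delta> \<le> real CARD('n)" and p: "\<delta> / real CARD('n) < p"
    and G: "choquet_integral (hausdorff_content \<delta>) UNIV (\<lambda>x. ennreal_powr (e2ennreal \<bar>f x\<bar>) p) = 0"
  shows "content_maximal \<kappa> f x = 0"
proof -
  let ?n = "real CARD('n)"
  let ?D = "1 + 1 / (1 - 2 powr (1 - p * real CARD('n) / \<delta>))"
  have "choquet_integral (hausdorff_content ?n) (ball x r) (\<lambda>y. e2ennreal \<bar>f y\<bar>) = 0" if r: "r > 0" for r
  proof -
    have "choquet_integral (hausdorff_content ?n) (ball x r) (\<lambda>y. e2ennreal \<bar>f y\<bar>) \<le> 0"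
    proof (rule tendsto_lowerbound)
      have "((\<lambda>T. ennreal (?D * (T * r ^ CARD('n)))) \<longlongrightarrow> ennreal (?D * (0 * r ^ CARD('n)))) (at_right 0)"
        by (intro tendsto_intros)
      then show "((\<lambda>T. ennreal (?D * (T * r ^ CARD('n)))) \<longlongrightarrow> 0) (at_right 0)" by simp
      show "\<forall>\<^sub>F T in at_right 0. choquet_integral (hausdorff_content ?n) (ball x r) (\<lambda>y. e2ennreal \<bar>f y\<bar>) \<le>
          ennreal (?D * (T * r ^ CARD('n)))"
      proof (rule eventually_at_rightI[of 0 1])
        fix T :: real assume "T \<in> {0<..<1}"
        then show "choquet_integral (hausdorff_content ?n) (ball x r) (\<lambda>y. e2ennreal \<bar>f y\<bar>) \<le>
          ennreal (?D * (T * r ^ CARD('n)))"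
          by (intro choquet_ball_le_powr[OF d p _ r, where G=0]) (auto simp: G)
      qed simp
    qed simp
    then show ?thesis by simp
  qed
  then show ?thesis unfolding content_maximal_def by simp
qed

theorem theorem4p15:
  fixes \<delta> \<kappa> p :: real
  assumes "0 < \<delta>" and "\<delta> \<le> real CARD('n)"
    and "0 \<le> \<kappa>" and "\<kappa> < \<delta>"
    and "\<delta> / real CARD('n) < p"
    and "\<kappa> = 0 \<or> p < \<delta> / \<kappa>"
  shows "\<exists>c::real. c > 0 \<and> (\<forall>f :: real ^ 'n \<Rightarrow> ereal.
    ennreal_powr
      (choquet_integral (hausdorff_content \<delta>) UNIV
        (\<lambda>x. ennreal_powr (content_maximal \<kappa> f x) (\<delta> * p / (\<delta> - p * \<kappa>))))
      ((\<delta> - p * \<kappa>) / (\<delta> * p))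
    \<le> ennreal c *
      ennreal_powr
        (choquet_integral (hausdorff_content \<delta>) UNIV (\<lambda>x. ennreal_powr (e2ennreal \<bar>f x\<bar>) p))
        (1 / p))"
proof -
  let ?n = "real CARD('n)"
  note d = assms(1,2) and p = assms(5)
  have p0: "p > 0" by (rule supercritical_exponent(1)[OF d(1) p])
  have k: "0 \<le> \<kappa>" "p * \<kappa> < \<delta>" using assms by (cases "\<kappa> = 0"; simp add: pos_less_divide_eq)+
  obtain A :: real where A: "A > 0" and strong: "\<And>f :: real ^ 'n \<Rightarrow> ereal.
    choquet_integral (hausdorff_content \<delta>) UNIV (\<lambda>x. ennreal_powr (content_maximal 0 f x) p) \<le>
    ennreal A * choquet_integral (hausdorff_content \<delta>) UNIV (\<lambda>x. ennreal_powr (e2ennreal \<bar>f x\<bar>) p)"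
    by (rule maximal_strong_type[OF d p]) blast
  define D where "D = 1 + 1 / (1 - 2 powr (1 - p * ?n / \<delta>))"
  have D: "D > 0"
    using supercritical_exponent(2)[OF d(1) p] by (simp add: D_def add_pos_pos)
  define \<theta> where "\<theta> = p * \<kappa> / \<delta>"
  define s where "s = \<delta> * p / (\<delta> - p * \<kappa>)"
  have s0: "s > 0" using d k p0 by (simp add: s_def)
  have \<theta>s: "(1 - \<theta>) * s = p" using d k by (simp add: \<theta>_def s_def field_simps)
  \<comment> \<open>Homogeneity: the powers of \<open>G\<close> from Hedberg's inequality and from the strong type estimate
    combine to the power \<open>1 / p\<close>.\<close>
  have exps: "\<theta> / p + 1 / s = 1 / p" using d k p0 by (simp add: \<theta>_def s_def field_simps)
  have inv_s: "(\<delta> - p * \<kappa>) / (\<delta> * p) = 1 / s" by (simp add: s_def)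
  define c where "c = D powr \<theta> * A powr (1 / s)"
  have c: "c > 0" using A D by (simp add: c_def)
  show ?thesis
  proof (intro exI[of _ c] conjI allI c)
    fix f :: "real ^ 'n \<Rightarrow> ereal"
    let ?G = "choquet_integral (hausdorff_content \<delta>) UNIV (\<lambda>x. ennreal_powr (e2ennreal \<bar>f x\<bar>) p)"
    consider "?G = top" | "?G = 0" | G where "?G = ennreal G" "G > 0"
      by (cases ?G) (auto simp: less_le)
    then have "ennreal_powr (choquet_integral (hausdorff_content \<delta>) UNIV (\<lambda>x. ennreal_powr (content_maximal \<kappa> f x) s)) (1 / s)
        \<le> ennreal c * ennreal_powr ?G (1 / p)"
    proof cases
      case 1
      then show ?thesis using c by (simp add: ennreal_powr_def ennreal_mult_top)
    next
      case 2
      then have "content_maximal \<kappa> f x = 0" for x by (rule content_maximal_eq_0[OF d p])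
      then show ?thesis by (simp add: ennreal_powr_def choquet_integral_def hausdorff_content_empty)
    next
      case 3
      define B where "B = (D * G powr (1 / p)) powr \<theta>"
      have B: "B > 0" using D 3 by (simp add: B_def)
      have "ennreal_powr (content_maximal \<kappa> f x) s \<le> ennreal (B powr s) * ennreal_powr (content_maximal 0 f x) p" for x
      proof (cases "content_maximal 0 f x")
        case (real u)
        have "content_maximal \<kappa> f x \<le> ennreal (B * u powr (1 - \<theta>))"
          unfolding B_def D_def \<theta>_def
          by (rule content_maximal_le_Hedberg[OF d p k]) (use 3 real in auto)
        then have "ennreal_powr (content_maximal \<kappa> f x) s \<le> ennreal ((B * u powr (1 - \<theta>)) powr s)"
          using B s0 by (intro ennreal_powr_le) auto
        also have "(B * u powr (1 - \<theta>)) powr s = B powr s * u powr p"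
          using B by (simp add: powr_mult powr_powr \<theta>s)
        finally show ?thesis using real by (simp add: ennreal_powr_def ennreal_mult)
      next
        case top
        then show ?thesis using B by (simp add: ennreal_powr_def ennreal_mult_top)
      qed
      then have "choquet_integral (hausdorff_content \<delta>) UNIV (\<lambda>x. ennreal_powr (content_maximal \<kappa> f x) s) \<le>
          choquet_integral (hausdorff_content \<delta>) UNIV (\<lambda>x. ennreal (B powr s) * ennreal_powr (content_maximal 0 f x) p)"
        by (rule choquet_mono)
      also have "\<dots> = ennreal (B powr s) * choquet_integral (hausdorff_content \<delta>) UNIV (\<lambda>x. ennreal_powr (content_maximal 0 f x) p)"
        using B by (intro choquet_cmult) simp
      also have "\<dots> \<le> ennreal (B powr s) * (ennreal A * ennreal G)"
        using strong[of f] 3 by (intro mult_left_mono) auto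
      also have "\<dots> = ennreal (B powr s * (A * G))"
        using A B 3 by (simp add: ennreal_mult)
      finally have "ennreal_powr (choquet_integral (hausdorff_content \<delta>) UNIV (\<lambda>x. ennreal_powr (content_maximal \<kappa> f x) s)) (1 / s)
          \<le> ennreal ((B powr s * (A * G)) powr (1 / s))"
        using A B 3 s0 by (intro ennreal_powr_le) auto
      also have "(B powr s * (A * G)) powr (1 / s) = B * (A powr (1 / s) * G powr (1 / s))"
        using A B 3 s0 by (simp add: powr_mult powr_powr)
      also have "B = D powr \<theta> * G powr (\<theta> / p)"
        using D 3 by (simp add: B_def powr_mult powr_powr)
      also have "D powr \<theta> * G powr (\<theta> / p) * (A powr (1 / s) * G powr (1 / s)) = c * G powr (\<theta> / p + 1 / s)"
        by (simp add: c_def powr_add mult_ac)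
      also have "ennreal (c * G powr (\<theta> / p + 1 / s)) = ennreal c * ennreal_powr ?G (1 / p)"
        unfolding exps using c 3 by (simp add: ennreal_powr_def ennreal_mult)
      finally show ?thesis .
    qed
    then show "ennreal_powr
      (choquet_integral (hausdorff_content \<delta>) UNIV
        (\<lambda>x. ennreal_powr (content_maximal \<kappa> f x) (\<delta> * p / (\<delta> - p * \<kappa>))))
      ((\<delta> - p * \<kappa>) / (\<delta> * p)) \<le> ennreal c * ennreal_powr ?G (1 / p)"
      unfolding inv_s s_def[symmetric] .
  qed
qed

end
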